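(* Let $\Omega$ be a (possibly infinite) set, let $G \leqslant \mathrm{Sym}(\Omega)$ be semiprimitive and suppose that $G$ contains a $p$-cycle for some prime $p$. Then $G$ is primitive.
   Context: A permutation group is semiregular if all its point-stabilisers are trivial. A transitive permutation group is semiprimitive if every normal subgroup is transitive or semiregular. A $p$-cycle is a permutation that cyclically permutes $p$ points and fixes all other points of $\Omega$. *)

theory Defs
  imports
    "HOL-Algebra.Group_Action"
    "HOL-Combinatorics.Cycles"
    "HOL-Library.Disjoint_Sets"
    "HOL-Computational_Algebra.Primes"
begin

text \<open>
  \<^term>\<open>BijGroup \<Omega>\<close> is the symmetric group on \<^term>\<open>\<Omega>\<close>, which may be infinite. Its elements are
  extensional functions, i.e. they take the value \<^term>\<open>undefined\<close> outside \<^term>\<open>\<Omega>\<close>. A permutation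
  group is a subset \<^term>\<open>G\<close> with \<^term>\<open>subgroup G (BijGroup \<Omega>)\<close>, acting on \<^term>\<open>\<Omega>\<close> by evaluation.
\<close>

definition perm_group :: "'a set \<Rightarrow> ('a \<Rightarrow> 'a) set \<Rightarrow> ('a \<Rightarrow> 'a) monoid" where
  "perm_group \<Omega> G = (BijGroup \<Omega>)\<lparr>carrier := G\<rparr>"

definition transitive_perm_group :: "'a set \<Rightarrow> ('a \<Rightarrow> 'a) set \<Rightarrow> bool" where
  "transitive_perm_group \<Omega> G \<longleftrightarrow> transitive_action (perm_group \<Omega> G) \<Omega> (\<lambda>g. g)"

definition semiregular_perm_group :: "'a set \<Rightarrow> ('a \<Rightarrow> 'a) set \<Rightarrow> bool" where
  "semiregular_perm_group \<Omega> G \<longleftrightarrow>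
     (\<forall>x\<in>\<Omega>. stabilizer (perm_group \<Omega> G) (\<lambda>g. g) x = {\<one>\<^bsub>perm_group \<Omega> G\<^esub>})"

definition semiprimitive_perm_group :: "'a set \<Rightarrow> ('a \<Rightarrow> 'a) set \<Rightarrow> bool" where
  "semiprimitive_perm_group \<Omega> G \<longleftrightarrow>
     transitive_perm_group \<Omega> G \<and>
     (\<forall>N. normal N (perm_group \<Omega> G) \<longrightarrow>
        transitive_perm_group \<Omega> N \<or> semiregular_perm_group \<Omega> N)"

definition invariant_partition :: "'a set \<Rightarrow> ('a \<Rightarrow> 'a) set \<Rightarrow> 'a set set \<Rightarrow> bool" where
  "invariant_partition \<Omega> G P \<longleftrightarrow> partition_on \<Omega> P \<and> (\<forall>g\<in>G. \<forall>B\<in>P. g ` B \<in> P)"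

definition primitive_perm_group :: "'a set \<Rightarrow> ('a \<Rightarrow> 'a) set \<Rightarrow> bool" where
  "primitive_perm_group \<Omega> G \<longleftrightarrow>
     transitive_perm_group \<Omega> G \<and>
     (\<forall>P. invariant_partition \<Omega> G P \<longrightarrow> P = {\<Omega>} \<or> P = (\<lambda>x. {x}) ` \<Omega>)"

text \<open>
  \<^const>\<open>cycle_of_list\<close> is the identity outside its support, so it has to be restricted
  to \<^term>\<open>\<Omega>\<close> to become an element of \<^term>\<open>BijGroup \<Omega>\<close>.
\<close>

definition is_p_cycle :: "'a set \<Rightarrow> nat \<Rightarrow> ('a \<Rightarrow> 'a) \<Rightarrow> bool" where
  "is_p_cycle \<Omega> p g \<longleftrightarrow>
     (\<exists>cs. cycle cs \<and> length cs = p \<and> set cs \<subseteq> \<Omega> \<and> g = restrict (cycle_of_list cs) \<Omega>)"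

lemma transitive_perm_group_iff:
  assumes "subgroup G (BijGroup \<Omega>)"
  shows "transitive_perm_group \<Omega> G \<longleftrightarrow> (\<forall>x\<in>\<Omega>. \<forall>y\<in>\<Omega>. \<exists>g\<in>G. g x = y)"
proof -
  interpret B: group "BijGroup \<Omega>" by (rule group_BijGroup)
  have "group_hom (perm_group \<Omega> G) (BijGroup \<Omega>) (\<lambda>g. g)"
    using B.subgroup_imp_group[OF assms] subgroup.subset[OF assms]
    by (auto simp: group_hom_def group_hom_axioms_def hom_def perm_group_def B.group_axioms)
  then have "group_action (perm_group \<Omega> G) \<Omega> (\<lambda>g. g)"
    by (simp add: group_action_def)
  then show ?thesis
    by (auto simp: transitive_perm_group_def transitive_action_def
        transitive_action_axioms_def perm_group_def)
qed

lemma is_p_cycle_in_BijGroup: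
  assumes "is_p_cycle \<Omega> p g"
  shows "g \<in> carrier (BijGroup \<Omega>)"
proof -
  from assms obtain cs where "set cs \<subseteq> \<Omega>" and g: "g = restrict (cycle_of_list cs) \<Omega>"
    by (auto simp: is_p_cycle_def)
  then have "cycle_of_list cs permutes \<Omega>"
    using cycle_permutes permutes_subset by blast
  then have "bij_betw (cycle_of_list cs) \<Omega> \<Omega>"
    by (rule permutes_imp_bij)
  then have "bij_betw g \<Omega> \<Omega>"
    unfolding g by (subst bij_betw_cong[where g = "cycle_of_list cs"]) auto
  then show ?thesis
    by (simp add: BijGroup_def Bij_def g)
qed

end

theory Submission
  imports Defs
begin

text \<open>
  Suppose that the invariant partition \<open>P\<close> is neither \<open>{\<Omega>}\<close> nor the partition into singletons, and
  let \<open>g \<in> G\<close> be a \<open>p\<close>-cycle with support \<open>C\<close>. If \<open>g\<close> moves some block, then the union of the moved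
  blocks is \<open>g\<close>-invariant and contained in \<open>C\<close>, hence equal to \<open>C\<close>. All blocks have the same size,
  which therefore divides \<open>p\<close>, so it is \<open>p\<close>; but then \<open>C\<close> itself is a moved block, which is absurd.
  So \<open>g\<close> lies in the kernel of the action of \<open>G\<close> on \<open>P\<close>. Then \<open>C\<close> lies in a single block, and
  \<open>g\<close> fixes the other blocks pointwise; so the kernel is neither transitive nor semiregular.
\<close>

text \<open>Described directly rather than as the kernel of a homomorphism into
  \<open>BijGroup P\<close>; the group laws are then checked on images of blocks.\<close>

definition block_kernel :: "('a \<Rightarrow> 'a) set \<Rightarrow> 'a set set \<Rightarrow> ('a \<Rightarrow> 'a) set" where
  "block_kernel G P = {g \<in> G. \<forall>B\<in>P. g ` B = B}"

lemma BijGroup_mult_image: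
  assumes "f \<in> carrier (BijGroup \<Omega>)" "g \<in> carrier (BijGroup \<Omega>)" "B \<subseteq> \<Omega>"
  shows "(f \<otimes>\<^bsub>BijGroup \<Omega>\<^esub> g) ` B = f ` g ` B"
proof -
  have "(f \<otimes>\<^bsub>BijGroup \<Omega>\<^esub> g) x = f (g x)" if "x \<in> B" for x
    using assms that by (auto simp: BijGroup_def compose_def)
  then show ?thesis
    by (auto simp: image_image)
qed

lemma BijGroup_inv_image:
  assumes f: "f \<in> carrier (BijGroup \<Omega>)" and B: "B \<subseteq> \<Omega>"
  shows "(inv\<^bsub>BijGroup \<Omega>\<^esub> f) ` f ` B = B"
proof -
  interpret group "BijGroup \<Omega>" by (rule group_BijGroup)
  have "(inv\<^bsub>BijGroup \<Omega>\<^esub> f) ` f ` B = \<one>\<^bsub>BijGroup \<Omega>\<^esub> ` B"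
    using BijGroup_mult_image[OF inv_closed[OF f] f B] f by simp
  also have "\<dots> = B"
    using B by (auto simp: BijGroup_def)
  finally show ?thesis .
qed

lemma BijGroup_inj_on: "f \<in> carrier (BijGroup \<Omega>) \<Longrightarrow> inj_on f \<Omega>"
  by (simp add: BijGroup_def Bij_def bij_betw_def)

text \<open>Stated inside \<open>BijGroup \<Omega>\<close> rather than inside \<open>G\<close>, the
  form that \<open>transitive_perm_group_iff\<close> asks for when it is applied to the
  kernel.\<close>

lemma subgroup_block_kernel:
  assumes G: "subgroup G (BijGroup \<Omega>)" and P: "\<And>B. B \<in> P \<Longrightarrow> B \<subseteq> \<Omega>"
  shows "subgroup (block_kernel G P) (BijGroup \<Omega>)"
proof -
  interpret group "BijGroup \<Omega>" by (rule group_BijGroup)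
  interpret G: subgroup G "BijGroup \<Omega>" by (rule G)
  show ?thesis
  proof (rule subgroupI)
    show "block_kernel G P \<subseteq> carrier (BijGroup \<Omega>)"
      by (auto simp: block_kernel_def)
    have "\<one>\<^bsub>BijGroup \<Omega>\<^esub> ` B = B" if "B \<in> P" for B
      using P[OF that] by (auto simp: BijGroup_def)
    then have "\<one>\<^bsub>BijGroup \<Omega>\<^esub> \<in> block_kernel G P"
      by (simp add: block_kernel_def)
    then show "block_kernel G P \<noteq> {}"
      by blast
    show "inv\<^bsub>BijGroup \<Omega>\<^esub> a \<in> block_kernel G P" if "a \<in> block_kernel G P" for a
    proof -
      have "(inv\<^bsub>BijGroup \<Omega>\<^esub> a) ` B = B" if "B \<in> P" for B
        using BijGroup_inv_image[of a \<Omega> B] P[OF that] \<open>a \<in> block_kernel G P\<close> that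
        by (simp add: block_kernel_def)
      then show ?thesis
        using that by (simp add: block_kernel_def)
    qed
    show "a \<otimes>\<^bsub>BijGroup \<Omega>\<^esub> b \<in> block_kernel G P"
      if "a \<in> block_kernel G P" "b \<in> block_kernel G P" for a b
      using that P BijGroup_mult_image[of a \<Omega> b] by (simp add: block_kernel_def)
  qed
qed

text \<open>For a conjugate of \<open>h\<close> by \<open>x\<close>: the inverse of \<open>x\<close>
  sends \<open>B\<close> to another block by invariance, \<open>h\<close> fixes that block, and
  \<open>x\<close> brings it back to \<open>B\<close>.\<close>

lemma normal_block_kernel:
  assumes G: "subgroup G (BijGroup \<Omega>)" and P: "invariant_partition \<Omega> G P"
  shows "normal (block_kernel G P) (perm_group \<Omega> G)"
proof -
  interpret B: group "BijGroup \<Omega>" by (rule group_BijGroup)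
  interpret G: subgroup G "BijGroup \<Omega>" by (rule G)
  interpret group "perm_group \<Omega> G"
    unfolding perm_group_def by (rule B.subgroup_imp_group[OF G])
  have sub: "B \<subseteq> \<Omega>" if "B \<in> P" for B
    using P that by (auto simp: invariant_partition_def partition_on_def)
  have inv: "g ` B \<in> P" if "g \<in> G" "B \<in> P" for g B
    using P that by (auto simp: invariant_partition_def)
  show ?thesis
  proof (rule normal_invI)
    show "subgroup (block_kernel G P) (perm_group \<Omega> G)"
      unfolding perm_group_def
      by (rule B.subgroup_incl[OF subgroup_block_kernel[OF G sub] G])
        (auto simp: block_kernel_def)
    fix x h assume "x \<in> carrier (perm_group \<Omega> G)" and h: "h \<in> block_kernel G P"
    then have x: "x \<in> G" and hG: "h \<in> G"
      by (auto simp: perm_group_def block_kernel_def)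
    let ?y = "inv\<^bsub>BijGroup \<Omega>\<^esub> x"
    have y: "?y \<in> G" using x by simp
    have "(x \<otimes>\<^bsub>BijGroup \<Omega>\<^esub> h \<otimes>\<^bsub>BijGroup \<Omega>\<^esub> ?y) ` B = B" if "B \<in> P" for B
    proof -
      have "?y ` B \<in> P" using inv y that .
      moreover have "x ` ?y ` B = B"
        using BijGroup_inv_image[of ?y \<Omega> B] sub[OF that] x by simp
      ultimately show ?thesis
        using h x y hG sub that by (simp add: BijGroup_mult_image block_kernel_def)
    qed
    then show "x \<otimes>\<^bsub>perm_group \<Omega> G\<^esub> h \<otimes>\<^bsub>perm_group \<Omega> G\<^esub> inv\<^bsub>perm_group \<Omega> G\<^esub> x \<in> block_kernel G P"
      using x hG y
      by (simp add: perm_group_def block_kernel_def flip: B.m_inv_consistent[OF G x])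
  qed
qed

text \<open>All iterates of a point of \<open>S\<close> stay in \<open>S\<close>, and the iterates
  of one entry of \<open>cs\<close> run through all entries.\<close>

lemma invariant_set_contains_cycle:
  assumes cs: "cycle cs" and S: "cycle_of_list cs ` S \<subseteq> S" and meet: "S \<inter> set cs \<noteq> {}"
  shows "set cs \<subseteq> S"
proof
  fix y assume "y \<in> set cs"
  then obtain j where j: "j < length cs" "y = cs ! j"
    by (auto simp: in_set_conv_nth)
  obtain i where i: "i < length cs" "cs ! i \<in> S"
    using meet by (auto simp: in_set_conv_nth)
  have pow: "(cycle_of_list cs ^^ n) (cs ! i) \<in> S" for n
    using S i by (induction n) auto
  \<comment> \<open>Iterating the cycle \<open>n\<close> times shifts indices by \<open>n\<close>
    modulo \<open>length cs\<close>, so \<open>i\<close> has to be shifted by \<open>j - i\<close>.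
    The extra \<open>length cs\<close> keeps the exponent a natural number when
    \<open>j < i\<close>.\<close>
  let ?n = "length cs - i + j"
  have "(cycle_of_list cs ^^ ?n) (cs ! i) = map (cycle_of_list cs ^^ ?n) cs ! i"
    using i by simp
  also have "\<dots> = cs ! j"
    using i j by (simp add: cyclic_rotation[OF cs] nth_rotate)
  finally show "y \<in> S"
    using pow[of ?n] j by simp
qed

text \<open>A fixed point in the support would be an invariant singleton meeting \<open>cs\<close>,
  hence would contain all of \<open>set cs\<close>.\<close>

lemma cycle_of_list_moves:
  assumes "cycle cs" "2 \<le> length cs" "x \<in> set cs"
  shows "cycle_of_list cs x \<noteq> x"
proof
  assume "cycle_of_list cs x = x"
  then have "set cs \<subseteq> {x}"
    using assms by (intro invariant_set_contains_cycle) auto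
  then have "card (set cs) \<le> 1"
    using card_mono[of "{x}" "set cs"] by simp
  then show False
    using assms by (simp add: distinct_card)
qed

text \<open>A group element taking a point of \<open>A\<close> to a point of \<open>B\<close> takes
  \<open>A\<close> bijectively onto \<open>B\<close>. Blocks are nonempty, so the value 0 of
  \<open>card\<close> means exactly that the blocks are infinite.\<close>

lemma invariant_partition_card_eq:
  assumes G: "subgroup G (BijGroup \<Omega>)" and trans: "transitive_perm_group \<Omega> G"
    and P: "invariant_partition \<Omega> G P" and "A \<in> P" "B \<in> P"
  shows "card A = card B"
proof -
  have part: "partition_on \<Omega> P" and inv: "\<And>g B. g \<in> G \<Longrightarrow> B \<in> P \<Longrightarrow> g ` B \<in> P"
    using P by (auto simp: invariant_partition_def)
  have sub: "A \<subseteq> \<Omega>" "B \<subseteq> \<Omega>" and "A \<noteq> {}" "B \<noteq> {}"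
    using part \<open>A \<in> P\<close> \<open>B \<in> P\<close> by (auto simp: partition_on_def)
  then obtain a b where "a \<in> A" "b \<in> B"
    by blast
  then obtain g where g: "g \<in> G" "g a = b"
    using trans sub unfolding transitive_perm_group_iff[OF G] by blast
  have "b \<in> g ` A"
    using g(2) \<open>a \<in> A\<close> by blast
  then have "g ` A = B"
    using disjointD[OF partition_onD2[OF part] inv[OF g(1) \<open>A \<in> P\<close>] \<open>B \<in> P\<close>] \<open>b \<in> B\<close> by blast
  moreover have "inj_on g A"
    using inj_on_subset[OF BijGroup_inj_on[OF subgroup.mem_carrier[OF G g(1)]] sub(1)] .
  ultimately show ?thesis
    using card_image[of g A] by simp
qed

theorem lemma10p1:
  fixes \<Omega> :: "'a set" and G :: "('a \<Rightarrow> 'a) set" and p :: nat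
  assumes "subgroup G (BijGroup \<Omega>)"
    and "semiprimitive_perm_group \<Omega> G"
    and "prime p"
    and "\<exists>g\<in>G. is_p_cycle \<Omega> p g"
  shows "primitive_perm_group \<Omega> G"
proof -
  note G = assms(1)
  have trans: "transitive_perm_group \<Omega> G"
    using assms(2) by (simp add: semiprimitive_perm_group_def)
  obtain g cs where g: "g \<in> G" and cs: "cycle cs" "length cs = p" "set cs \<subseteq> \<Omega>"
    and g_eq: "g = restrict (cycle_of_list cs) \<Omega>"
    using assms(4) by (auto simp: is_p_cycle_def)
  have p: "p \<ge> 2" using assms(3) by (rule prime_ge_2_nat)
  have g_carrier: "g \<in> carrier (BijGroup \<Omega>)"
    using subgroup.mem_carrier[OF G g] .
  have g_fix: "g x = x" if "x \<in> \<Omega>" "x \<notin> set cs" for x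
    using that by (simp add: g_eq id_outside_supp)
  have g_image: "g ` S = cycle_of_list cs ` S" if "S \<subseteq> \<Omega>" for S
    using that by (auto simp: g_eq)
  have support: "set cs \<subseteq> S" if "S \<subseteq> \<Omega>" "g ` S \<subseteq> S" "S \<inter> set cs \<noteq> {}" for S
    using invariant_set_contains_cycle[OF cs(1), of S] that g_image by simp
  have "P = {\<Omega>} \<or> P = (\<lambda>x. {x}) ` \<Omega>" if P: "invariant_partition \<Omega> G P" for P
  proof (rule ccontr)
    assume nontrivial: "\<not> (P = {\<Omega>} \<or> P = (\<lambda>x. {x}) ` \<Omega>)"
    have part: "partition_on \<Omega> P" and inv: "\<And>h B. h \<in> G \<Longrightarrow> B \<in> P \<Longrightarrow> h ` B \<in> P"
      using P by (auto simp: invariant_partition_def)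
    have sub: "B \<subseteq> \<Omega>" and nonempty: "B \<noteq> {}" if "B \<in> P" for B
      using part that by (auto simp: partition_on_def)
    have block_eq: "A = B" if "A \<in> P" "B \<in> P" "x \<in> A" "x \<in> B" for A B x
      using part that unfolding partition_on_def disjoint_def by blast
    have cover: "\<exists>B\<in>P. x \<in> B" if "x \<in> \<Omega>" for x
      using part that by (auto simp: partition_on_def)
    \<comment> \<open>One singleton block would make all blocks singletons. Infinite blocks are not
      excluded here.\<close>
    have card_neq: "card B \<noteq> 1" if "B \<in> P" for B
    proof
      assume "card B = 1"
      then have single: "\<exists>x. A = {x}" if "A \<in> P" for A
        using invariant_partition_card_eq[OF G trans P that \<open>B \<in> P\<close>]
        by (metis card_1_singletonE)
      have "P = (\<lambda>x. {x}) ` \<Omega>"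
      proof (intro equalityI subsetI)
        fix A assume "A \<in> P"
        then show "A \<in> (\<lambda>x. {x}) ` \<Omega>" using single sub by blast
      next
        fix A assume "A \<in> (\<lambda>x. {x}) ` \<Omega>"
        then obtain x where "x \<in> \<Omega>" "A = {x}" by blast
        then show "A \<in> P" using cover single by (metis singletonD)
      qed
      then show False using nontrivial by blast
    qed
    have other: "\<exists>A\<in>P. A \<noteq> B" if "B \<in> P" for B
    proof (rule ccontr)
      assume "\<not> (\<exists>A\<in>P. A \<noteq> B)"
      then have "P = {B}" using that by blast
      then show False using nontrivial partition_onD1[OF part] by simp
    qed
    have block_fixed: "g ` B = B" if B: "B \<in> P" for B
    proof (rule ccontr)
      assume moved: "g ` B \<noteq> B"
      define M where "M = {D \<in> P. g ` D \<noteq> D}"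
      have BM: "B \<in> M" using B moved by (simp add: M_def)
      have M_support: "D \<subseteq> set cs" if "D \<in> M" for D
      proof
        fix x assume x: "x \<in> D"
        have D: "D \<in> P" "g ` D \<noteq> D" using that by (auto simp: M_def)
        show "x \<in> set cs"
        proof (rule ccontr)
          assume "x \<notin> set cs"
          then have "g x = x" using g_fix sub[OF D(1)] x by blast
          then have "x \<in> g ` D" using x by force
          then show False using block_eq[OF inv[OF g D(1)] D(1)] x D(2) by blast
        qed
      qed
      have M_inv: "g ` D \<in> M" if "D \<in> M" for D
      proof -
        have D: "D \<in> P" "g ` D \<noteq> D" using that by (auto simp: M_def)
        have "g ` g ` D \<noteq> g ` D"
          using D(2) inj_on_image_eq_iff[OF BijGroup_inj_on[OF g_carrier]
              sub[OF inv[OF g D(1)]] sub[OF D(1)]] by simp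
        then show ?thesis using inv[OF g D(1)] by (simp add: M_def)
      qed
      have "set cs \<subseteq> \<Union>M"
      proof (rule support)
        show "\<Union>M \<subseteq> \<Omega>" using sub by (auto simp: M_def)
        show "g ` \<Union>M \<subseteq> \<Union>M" using M_inv by blast
        show "\<Union>M \<inter> set cs \<noteq> {}" using BM M_support[OF BM] nonempty[OF B] by blast
      qed
      then have union: "\<Union>M = set cs" using M_support by blast
      \<comment> \<open>The union is the finite set \<open>set cs\<close>, partitioned into blocks
        of equal size. As its size is the prime \<open>p\<close>, the block size is 1 or
        \<open>p\<close>, and 1 has been excluded.\<close>
      have "card B dvd card (\<Union>M)"
      proof (rule dvd_partition)
        show "finite (\<Union>M)" by (simp add: union)
        show "\<forall>D\<in>M. card B dvd card D"
          using invariant_partition_card_eq[OF G trans P B]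
          by (metis (lifting) M_def dvd_refl mem_Collect_eq)
        show "\<forall>D\<in>M. \<forall>E\<in>M. D \<noteq> E \<longrightarrow> D \<inter> E = {}"
          using block_eq by (auto simp: M_def)
      qed
      then have "card B = p"
        using card_neq[OF B] prime_nat_iff assms(3) cs(1,2) by (auto simp: union distinct_card)
      then have "B = set cs"
        using M_support[OF BM] cs(1,2) by (intro card_subset_eq) (auto simp: distinct_card)
      \<comment> \<open>A cycle maps its own support onto itself, so \<open>B\<close> is not moved
        after all.\<close>
      then show False
        using moved cycle_is_surj[OF cs(1)] g_image[OF cs(3)] by simp
    qed
    let ?N = "block_kernel G P"
    have gN: "g \<in> ?N" using g block_fixed by (simp add: block_kernel_def)
    obtain c where c: "c \<in> set cs" using cs(2) p by (cases cs) auto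
    then obtain B where B: "B \<in> P" "c \<in> B" using cover cs(3) by blast
    \<comment> \<open>The point \<open>a\<close> chosen in this second block refutes both
      alternatives: kernel elements keep it in \<open>A\<close>, so none takes it to
      \<open>c\<close>; and it is fixed by \<open>g\<close>, whose support turns out to lie in
      \<open>B\<close>.\<close>
    obtain A where A: "A \<in> P" "A \<noteq> B" using other[OF B(1)] by blast
    obtain a where a: "a \<in> A" using nonempty[OF A(1)] by blast
    have a\<Omega>: "a \<in> \<Omega>" using a sub[OF A(1)] by blast
    have "\<not> transitive_perm_group \<Omega> ?N"
    proof
      assume "transitive_perm_group \<Omega> ?N"
      then obtain h where h: "h \<in> ?N" "h a = c"
        using transitive_perm_group_iff[OF subgroup_block_kernel[OF G sub]] a\<Omega> c cs(3) by blast
      then have "c \<in> A" using a A(1) by (auto simp: block_kernel_def)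
      then show False using block_eq A B by blast
    qed
    moreover have "\<not> semiregular_perm_group \<Omega> ?N"
    proof
      assume semireg: "semiregular_perm_group \<Omega> ?N"
      have "set cs \<subseteq> B"
        using support[OF sub[OF B(1)]] block_fixed[OF B(1)] B(2) c by blast
      then have "a \<notin> set cs" using block_eq A B(1) a by blast
      then have "g \<in> stabilizer (perm_group \<Omega> ?N) (\<lambda>g. g) a"
        using gN g_fix a\<Omega> by (simp add: stabilizer_def perm_group_def)
      then have "g = (\<lambda>x\<in>\<Omega>. x)"
        using semireg a\<Omega> unfolding semiregular_perm_group_def
        by (simp add: perm_group_def BijGroup_def)
      \<comment> \<open>Semiregularity makes \<open>g\<close> the identity, although a cycle of
        length at least 2 moves \<open>c\<close>.\<close>
      then have "cycle_of_list cs c = c"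
        using g_eq c cs(3) by (metis restrict_apply' subsetD)
      then show False
        using cycle_of_list_moves[OF cs(1) _ c] cs(2) p by blast
    qed
    ultimately show False
      using assms(2) normal_block_kernel[OF G P] unfolding semiprimitive_perm_group_def by blast
  qed
  then show ?thesis
    using trans by (simp add: primitive_perm_group_def)
qed

end
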